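(* Let $r\in\mathbb R$, $m>0$, $d>1$ and $0<p<1$. Let $\mu_0,\mu_1,\dots,\mu_\ell$ be the sequence of distributions obtained by applying a sequence of moves to an initial distribution $\mu_0$ with $\mu_0\{x>r\}=0$. If $\mu_{\max}\{x>r\}\le m$ and $\mu_{\max}\{x\ge r+d\}\ge pm$, then the sequence contains at least $\sqrt3\,p^{3/2}(d-\frac12)^3$ moves whose centers lie in $(r+\frac12,\infty)$.
   Context: A distribution is a finite set $\{(x_1,m_1),\dots,(x_k,m_k)\}$, $m_i>0$; $\mu(A)=\sum_{x_i\in A}m_i$; $M_j[\mu]=\sum_im_ix_i^j$. A move $v=([a,b],\delta)$ has $b-a=1$, $\delta$ a signed distribution on $[a,b]$ with $M_0[\delta]=M_1[\delta]=0$, and center $\frac{a+b}2$; it applies to $\mu$ if $\mu+\delta$ is a distribution, and $v\mu=\mu+\delta$. For a sequence of moves producing $\mu_i=v_i\mu_{i-1}$, $\mu_{\max}\{x>a\}=\max_{0\le i\le\ell}\mu_i\{x>a\}$ and $\mu_{\max}\{x\ge a\}=\max_{0\le i\le\ell}\mu_i\{x\ge a\}$. *)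

theory Defs
  imports Complex_Main
begin

text \<open>A (signed) distribution is represented by its mass function
  real \<Rightarrow> real with finite support: the pair (x_i, m_i) corresponds to f x_i = m_i.\<close>

definition supp :: "(real \<Rightarrow> real) \<Rightarrow> real set" where
  "supp f = {x. f x \<noteq> 0}"

definition signed_distribution :: "(real \<Rightarrow> real) \<Rightarrow> bool" where
  "signed_distribution f \<longleftrightarrow> finite (supp f)"

definition distribution :: "(real \<Rightarrow> real) \<Rightarrow> bool" where
  "distribution f \<longleftrightarrow> finite (supp f) \<and> (\<forall>x. f x \<ge> 0)"

definition mass :: "(real \<Rightarrow> real) \<Rightarrow> real set \<Rightarrow> real" where
  "mass f A = (\<Sum>x\<in>supp f \<inter> A. f x)"

definition moment :: "nat \<Rightarrow> (real \<Rightarrow> real) \<Rightarrow> real" where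
  "moment j f = (\<Sum>x\<in>supp f. f x * x ^ j)"

type_synonym move = "real \<times> real \<times> (real \<Rightarrow> real)"

definition is_move :: "move \<Rightarrow> bool" where
  "is_move v \<longleftrightarrow> (case v of (a, b, \<delta>) \<Rightarrow>
     b - a = 1 \<and> signed_distribution \<delta> \<and> supp \<delta> \<subseteq> {a..b}
     \<and> moment 0 \<delta> = 0 \<and> moment 1 \<delta> = 0)"

definition move_center :: "move \<Rightarrow> real" where
  "move_center v = (case v of (a, b, _) \<Rightarrow> (a + b) / 2)"

definition applies :: "move \<Rightarrow> (real \<Rightarrow> real) \<Rightarrow> bool" where
  "applies v \<mu> \<longleftrightarrow> (case v of (_, _, \<delta>) \<Rightarrow> distribution (\<lambda>x. \<mu> x + \<delta> x))"

definition apply_move :: "move \<Rightarrow> (real \<Rightarrow> real) \<Rightarrow> (real \<Rightarrow> real)" where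
  "apply_move v \<mu> = (case v of (_, _, \<delta>) \<Rightarrow> (\<lambda>x. \<mu> x + \<delta> x))"

definition mu_max :: "(nat \<Rightarrow> real \<Rightarrow> real) \<Rightarrow> nat \<Rightarrow> real set \<Rightarrow> real" where
  "mu_max \<mu> l A = Max ((\<lambda>i. mass (\<mu> i) A) ` {0..l})"

end

theory Submission
  imports Defs "HOL-Analysis.Analysis"
begin

text \<open>
  Put the origin at $r + 1/2$, normalise $m = 1$ and let $D = d - 1/2$. The distribution to the right
  of $-1/2$ is dominated, in the sense of the potentials $t \mapsto \sum_x \mu(x) (x-t)^+$, by a
  profile $G$, the tail function of a fictitious mass. A move centered at $c > 0$ is answered by
  resetting $G$ to $1$ on $t \le 1/2$ (this absorbs all moves with center at most $0$, since the mass
  to the right of $-1/2$ is at most $1$) and then replacing $G$ by its mean on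
  $[c - 1/2, c + 1/2]$, which makes the dominating potential linear there.
  The energy $\int_0^\infty G (2-G) - 2 \gamma t G dt$ is zero at the start and, by completing squares,
  drops by at most $\gamma^2/24 + \gamma^2/12 = \gamma^2/8$ per answered move. Mass $p$ beyond $D$ forces
  $\int t G \ge p D^2 / 2$, so the final energy is at most $-2/(3\kappa)$ for
  $\kappa = (3 p D^2)^{-1/2}$ and $\gamma = 4 \kappa$.
\<close>

subsection \<open>Potentials of distributions\<close>

text \<open>The set \<open>A\<close> allows two uses. With \<open>A = UNIV\<close> a balanced
  \<delta> is invisible outside its interval; with \<open>A\<close> a right half-line, all moves
  confined to the left of it are invisible.\<close>

definition pot :: "real set \<Rightarrow> (real \<Rightarrow> real) \<Rightarrow> real \<Rightarrow> real" where
  "pot A f t = (\<Sum>x\<in>supp f \<inter> A. f x * max 0 (x - t))"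

lemma sum_over_superset:
  assumes "finite S" "supp f \<subseteq> S"
  shows "(\<Sum>x\<in>supp f \<inter> A. f x * g x) = (\<Sum>x\<in>S \<inter> A. f x * g x)"
  using assms by (intro sum.mono_neutral_left) (auto simp: supp_def)

lemma pot_add:
  assumes "finite (supp f)" "finite (supp g)"
  shows "pot A (\<lambda>x. f x + g x) t = pot A f t + pot A g t"
proof -
  let ?S = "supp f \<union> supp g"
  have fin: "finite ?S" using assms by simp
  have "supp (\<lambda>x. f x + g x) \<subseteq> ?S" by (auto simp: supp_def)
  then show ?thesis
    unfolding pot_def
    by (simp add: sum_over_superset[OF fin] flip: sum.distrib distrib_right)
qed

lemma pot_disjoint:
  assumes "supp f \<inter> A = {}"
  shows "pot A f t = 0"
  using assms by (simp add: pot_def)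

text \<open>For such \<open>t\<close> the kernel \<open>max 0 (x - t)\<close> is affine in
  \<open>x\<close> on \<open>{a..b}\<close>, and the two vanishing moments annihilate affine
  functions.\<close>

lemma pot_balanced_outside:
  assumes "supp \<delta> \<subseteq> {a..b}" "moment 0 \<delta> = 0" "moment 1 \<delta> = 0" "t \<le> a \<or> b \<le> t"
  shows "pot UNIV \<delta> t = 0"
  using assms(4)
proof
  assume "t \<le> a"
  then have "pot UNIV \<delta> t = (\<Sum>x\<in>supp \<delta>. \<delta> x * x ^ 1 - t * (\<delta> x * x ^ 0))"
    unfolding pot_def using assms(1) by (intro sum.cong) (auto simp: max_def algebra_simps)
  also have "\<dots> = moment 1 \<delta> - t * moment 0 \<delta>"
    by (simp add: moment_def sum_subtractf sum_distrib_left)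
  finally show ?thesis using assms by simp
next
  assume "b \<le> t"
  then show ?thesis
    unfolding pot_def using assms(1) by (intro sum.neutral) (auto simp: max_def)
qed

text \<open>Convexity of \<open>max 0 (x - t)\<close> in \<open>t\<close>, summed with nonnegative
  weights. Applied to the distribution after a move, this bounds its potential inside the interval
  by the values at the endpoints.\<close>

lemma pot_le_chord:
  assumes "distribution f" "a \<le> t" "t \<le> a + 1"
  shows "pot A f t \<le> (a + 1 - t) * pot A f a + (t - a) * pot A f (a + 1)"
proof -
  have "pot A f t \<le> (\<Sum>x\<in>supp f \<inter> A.
      f x * ((a + 1 - t) * max 0 (x - a) + (t - a) * max 0 (x - (a + 1))))"
    unfolding pot_def
  proof (intro sum_mono mult_left_mono)
    fix x
    have "x - t = (a + 1 - t) * (x - a) + (t - a) * (x - (a + 1))" by (simp add: algebra_simps)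
    moreover have "(a + 1 - t) * (x - a) \<le> (a + 1 - t) * max 0 (x - a)"
      "(t - a) * (x - (a + 1)) \<le> (t - a) * max 0 (x - (a + 1))"
      "0 \<le> (a + 1 - t) * max 0 (x - a)" "0 \<le> (t - a) * max 0 (x - (a + 1))"
      using assms by (auto intro: mult_left_mono)
    ultimately show "max 0 (x - t) \<le> (a + 1 - t) * max 0 (x - a) + (t - a) * max 0 (x - (a + 1))"
      by linarith
  qed (use assms in \<open>auto simp: distribution_def\<close>)
  then show ?thesis
    by (simp add: pot_def sum_distrib_left sum.distrib distrib_left mult.left_commute)
qed

text \<open>Going left from \<open>t'\<close> to \<open>t\<close>, only points beyond
  \<open>t\<close> gain, and each gains at most \<open>t' - t\<close> per unit of mass. This is how
  the bound on the mass beyond \<open>r\<close> enters.\<close>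

lemma pot_slope:
  assumes "distribution f" "t \<le> t'" "mass f {x. x > t} \<le> M"
  shows "pot UNIV f t \<le> pot UNIV f t' + M * (t' - t)"
proof -
  have fin: "finite (supp f)" and nn: "\<And>x. 0 \<le> f x" using assms(1) by (auto simp: distribution_def)
  have "pot UNIV f t \<le> (\<Sum>x\<in>supp f. f x * max 0 (x - t') + (if x \<in> {x. x > t} then f x * (t' - t) else 0))"
    unfolding pot_def Int_UNIV_right
  proof (intro sum_mono)
    fix x
    have "max 0 (x - t) \<le> max 0 (x - t') + (if x > t then t' - t else 0)" using assms(2) by auto
    from mult_left_mono[OF this nn[of x]]
    show "f x * max 0 (x - t) \<le> f x * max 0 (x - t') + (if x \<in> {x. x > t} then f x * (t' - t) else 0)"
      by (auto simp: algebra_simps split: if_splits)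
  qed
  also have "\<dots> = pot UNIV f t' + mass f {x. x > t} * (t' - t)"
    using fin by (simp add: pot_def sum.distrib mass_def sum_distrib_right Int_def
        flip: sum.inter_filter)
  also have "\<dots> \<le> pot UNIV f t' + M * (t' - t)"
    using assms by (simp add: mult_right_mono)
  finally show ?thesis .
qed

lemma pot_mono_set:
  assumes "distribution f" "A \<subseteq> B"
  shows "pot A f t \<le> pot B f t"
  unfolding pot_def using assms by (intro sum_mono2) (auto simp: distribution_def)

lemma pot_tail_eq:
  assumes "distribution f" "c \<le> t"
  shows "pot {c<..} f t = pot UNIV f t"
  unfolding pot_def using assms by (intro sum.mono_neutral_left) (auto simp: distribution_def max_def)

text \<open>Each point at or beyond \<open>e\<close> has kernel value at least \<open>e - t\<close>,
  and \<open>c < e\<close> ensures that the restriction to \<open>{c<..}\<close> discards none of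
  these points.\<close>

lemma pot_tail_ge:
  assumes "distribution f" "c < e" "q \<le> mass f {x. x \<ge> e}" "t \<le> e"
  shows "q * (e - t) \<le> pot {c<..} f t"
proof -
  have fin: "finite (supp f)" and nn: "\<And>x. 0 \<le> f x" using assms(1) by (auto simp: distribution_def)
  have "q * (e - t) \<le> mass f {x. x \<ge> e} * (e - t)" using assms by (simp add: mult_right_mono)
  also have "\<dots> = (\<Sum>x\<in>supp f \<inter> {x. x \<ge> e}. f x * (e - t))" by (simp add: mass_def sum_distrib_right)
  also have "\<dots> \<le> pot {x. x \<ge> e} f t"
    unfolding pot_def using nn by (intro sum_mono mult_left_mono) auto
  also have "\<dots> \<le> pot {c<..} f t" using assms by (intro pot_mono_set) auto
  finally show ?thesis .
qed

subsection \<open>Profiles and their energy\<close>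

text \<open>Finiteness of the set of discontinuities yields Borel measurability and permits the
  fundamental theorem of calculus with finitely many exceptional points.\<close>

definition profile :: "(real \<Rightarrow> real) \<Rightarrow> bool" where
  "profile G \<longleftrightarrow> (\<forall>t. 0 \<le> G t \<and> G t \<le> 1) \<and> finite {t. \<not> isCont G t}"

text \<open>The potential of the fictitious mass with tail function \<open>G\<close>. The cutoff
  \<open>R\<close> stands for infinity and keeps all integrals on compact intervals.\<close>

definition tail_integral :: "real \<Rightarrow> (real \<Rightarrow> real) \<Rightarrow> real \<Rightarrow> real" where
  "tail_integral R G t = integral {t..R} G"

definition energy :: "real \<Rightarrow> real \<Rightarrow> (real \<Rightarrow> real) \<Rightarrow> real" where
  "energy \<gamma> R G = integral {0..R} (\<lambda>t. G t * (2 - G t) - 2 * \<gamma> * t * G t)"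

section \<open>Integrability and modification of profiles\<close>

lemma profile_bounds: "profile G \<Longrightarrow> 0 \<le> G t" "profile G \<Longrightarrow> G t \<le> 1"
  by (auto simp: profile_def)

text \<open>\<open>G\<close> is Borel, being continuous off a finite set, and its values in
  \<open>{0..1}\<close> keep \<open>(t, G t)\<close> in a compact rectangle on which \<phi> is
  bounded.\<close>

lemma profile_integrable_compose:
  fixes \<phi> :: "real \<times> real \<Rightarrow> real"
  assumes G: "profile G" and \<phi>: "continuous_on UNIV \<phi>"
  shows "(\<lambda>t. \<phi> (t, G t)) integrable_on {a..b}"
proof -
  have [measurable]: "G \<in> borel_measurable borel"
    using G by (intro borel_measurable_continuous_countable_exceptions[of "{t. \<not> isCont G t}"])
      (auto simp: profile_def countable_finite intro!: continuous_at_imp_continuous_on)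
  have [measurable]: "\<phi> \<in> borel_measurable borel"
    using \<phi> by (rule borel_measurable_continuous_onI)
  have meas: "(\<lambda>t. \<phi> (t, G t)) \<in> borel_measurable borel" by measurable
  have "compact (\<phi> ` ({a..b} \<times> {0..1}))"
    using \<phi> by (intro compact_continuous_image compact_Times) (auto intro: continuous_on_subset)
  then obtain B where "\<And>y. y \<in> \<phi> ` ({a..b} \<times> {0..1}) \<Longrightarrow> norm y \<le> B"
    using compact_imp_bounded bounded_iff by metis
  then have B: "norm (\<phi> (t, G t)) \<le> B" if "t \<in> {a..b}" for t
    using that profile_bounds[OF G] by auto
  have "set_integrable lborel {a..b} (\<lambda>t. \<phi> (t, G t))"
    unfolding set_integrable_def using meas B
    by (intro integrableI_bounded_set_indicator[where B=B]) (auto simp: emeasure_lborel_Icc_eq)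
  then show ?thesis by (rule set_borel_integral_eq_integral)
qed

lemma profile_integrable:
  assumes "profile G"
  shows "G integrable_on {a..b}"
    and "(\<lambda>t. t * G t) integrable_on {a..b}"
    and "(\<lambda>t. G t * (2 - G t) - 2 * \<gamma> * t * G t) integrable_on {a..b}"
proof -
  have "continuous_on UNIV (\<lambda>z::real \<times> real. snd z)"
    "continuous_on UNIV (\<lambda>z::real \<times> real. fst z * snd z)"
    "continuous_on UNIV (\<lambda>z::real \<times> real. snd z * (2 - snd z) - 2 * \<gamma> * fst z * snd z)"
    by (intro continuous_intros)+
  from this[THEN profile_integrable_compose[OF assms]]
  show "G integrable_on {a..b}"
    and "(\<lambda>t. t * G t) integrable_on {a..b}"
    and "(\<lambda>t. G t * (2 - G t) - 2 * \<gamma> * t * G t) integrable_on {a..b}"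
    by simp_all
qed

lemma profile_const: "0 \<le> c \<Longrightarrow> c \<le> 1 \<Longrightarrow> profile (\<lambda>t. c)"
  by (simp add: profile_def)

text \<open>New discontinuities can arise only on the frontier of \<open>S\<close>; elsewhere the
  new function agrees locally with \<open>c\<close> or with \<open>G\<close>.\<close>

lemma profile_override:
  assumes G: "profile G" and c: "0 \<le> c" "c \<le> 1" and fr: "finite (frontier S)"
  shows "profile (\<lambda>t. if t \<in> S then c else G t)"
proof -
  let ?H = "\<lambda>t. if t \<in> S then c else G t"
  have "isCont ?H t" if t: "t \<notin> frontier S" "isCont G t" for t
  proof (cases "t \<in> interior S")
    case True
    have "eventually (\<lambda>x. x \<in> interior S) (nhds t)"
      using True by (intro eventually_nhds_in_open) auto
    then have "eventually (\<lambda>x. ?H x = c) (nhds t)"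
      by eventually_elim (use interior_subset in auto)
    then show ?thesis by (simp add: isCont_cong)
  next
    case False
    then have "t \<in> interior (- S)"
      using t by (simp add: frontier_def interior_complement)
    then have "eventually (\<lambda>x. x \<in> interior (- S)) (nhds t)"
      by (intro eventually_nhds_in_open) auto
    then have "eventually (\<lambda>x. ?H x = G x) (nhds t)"
      by eventually_elim (use interior_subset in auto)
    then show ?thesis using t by (simp add: isCont_cong)
  qed
  then have "{t. \<not> isCont ?H t} \<subseteq> frontier S \<union> {t. \<not> isCont G t}" by auto
  then have "finite {t. \<not> isCont ?H t}"
    using G fr by (auto simp: profile_def intro: finite_subset)
  then show ?thesis using G c by (simp add: profile_def)
qed

lemma has_integral_square:
  fixes a b c :: real
  assumes "a \<le> b"
  shows "((\<lambda>t. (t - c)\<^sup>2) has_integral ((b - c) ^ 3 - (a - c) ^ 3) / 3) {a..b}"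
proof -
  have "((\<lambda>t. (t - c)\<^sup>2) has_integral ((b - c) ^ 3 / 3 - (a - c) ^ 3 / 3)) {a..b}"
    using assms
    by (intro fundamental_theorem_of_calculus)
      (auto intro!: derivative_eq_intros simp flip: has_real_derivative_iff_has_vector_derivative)
  then show ?thesis by (simp add: diff_divide_distrib)
qed

section \<open>Tail integrals and the first moment\<close>

lemma tail_integral_combine:
  assumes "profile G" "s \<le> t" "t \<le> R"
  shows "tail_integral R G s = integral {s..t} G + tail_integral R G t"
  unfolding tail_integral_def using assms by (simp add: Henstock_Kurzweil_Integration.integral_combine profile_integrable)

lemma tail_integral_cong:
  assumes "\<And>x. t < x \<Longrightarrow> x \<le> R \<Longrightarrow> G x = H x"
  shows "tail_integral R G t = tail_integral R H t"
  unfolding tail_integral_def using assms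
  by (intro integral_spike[of "{t}"]) auto

text \<open>Integration by parts: with \<open>w\<close> the tail integral, \<open>t * w t\<close>
  has derivative \<open>w t - t * G t\<close> off the discontinuities of \<open>G\<close> and
  vanishes at both \<open>0\<close> and \<open>R\<close>.\<close>

lemma integral_first_moment:
  assumes G: "profile G" and R: "0 \<le> R"
  shows "(tail_integral R G has_integral integral {0..R} (\<lambda>t. t * G t)) {0..R}"
proof -
  let ?S = "{t. \<not> isCont G t}"
  let ?w = "tail_integral R G"
  have fin: "finite ?S" using G by (simp add: profile_def)
  have der: "(?w has_vector_derivative - G x) (at x)" if x: "x \<in> {0<..<R} - ?S" for x
  proof -
    have "((\<lambda>u. integral {0..u} G) has_vector_derivative G x) (at x within {0..R} - {})"
      using x by (intro integral_has_vector_derivative_continuous_at profile_integrable[OF G])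
        (auto intro: continuous_at_imp_continuous_at_within)
    then have "((\<lambda>u. integral {0..u} G) has_vector_derivative G x) (at x)"
      using x by (simp add: at_within_Icc_at)
    then have "((\<lambda>u. integral {0..R} G - integral {0..u} G) has_vector_derivative 0 - G x) (at x)"
      by (intro derivative_intros)
    moreover have "integral {0..R} G - integral {0..u} G = ?w u" if "u \<in> {0<..<R}" for u
      using tail_integral_combine[OF G, of 0 u R] that by (simp add: tail_integral_def)
    ultimately show ?thesis
      using has_vector_derivative_transform_within_open[of _ "0 - G x" x "{0<..<R}" ?w] x by auto
  qed
  have "((\<lambda>t. ?w t - t * G t) has_integral (R * ?w R - 0 * ?w 0)) {0..R}"
  proof (rule fundamental_theorem_of_calculus_interior_strong[OF fin R])
    show "((\<lambda>t. t * ?w t) has_vector_derivative ?w x - x * G x) (at x)" if "x \<in> {0<..<R} - ?S" for x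
      using der[OF that] unfolding has_real_derivative_iff_has_vector_derivative[symmetric]
      by (auto intro!: derivative_eq_intros)
    show "continuous_on {0..R} (\<lambda>t. t * ?w t)"
      unfolding tail_integral_def
      by (intro continuous_intros indefinite_integral_continuous_1' profile_integrable[OF G])
  qed
  moreover have "?w R = 0" by (simp add: tail_integral_def)
  ultimately have "((\<lambda>t. ?w t - t * G t) has_integral 0) {0..R}" by simp
  from has_integral_add[OF this integrable_integral[OF profile_integrable(2)[OF G]]]
  show ?thesis by simp
qed

text \<open>The first moment equals the integral of the tail integral, which on
  \<open>{0..D}\<close> lies above a triangle of area \<open>p * D^2 / 2\<close> and is nonnegative
  beyond.\<close>

lemma first_moment_ge:
  assumes G: "profile G" and D: "0 \<le> D" "D \<le> R"
    and ge: "\<And>t. 0 \<le> t \<Longrightarrow> t \<le> D \<Longrightarrow> p * (D - t) \<le> tail_integral R G t"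
  shows "p * D\<^sup>2 / 2 \<le> integral {0..R} (\<lambda>t. t * G t)"
proof -
  have int: "tail_integral R G integrable_on {0..R}"
    and eq: "integral {0..R} (tail_integral R G) = integral {0..R} (\<lambda>t. t * G t)"
    using integral_first_moment[OF G, of R] D by (auto simp: has_integral_iff)
  have "((\<lambda>t. p * (D - t)) has_integral (- p * (D - D)\<^sup>2 / 2 - - p * (D - 0)\<^sup>2 / 2)) {0..D}"
    using D by (intro fundamental_theorem_of_calculus)
      (auto intro!: derivative_eq_intros simp: field_simps simp flip: has_real_derivative_iff_has_vector_derivative)
  then have "p * D\<^sup>2 / 2 \<le> integral {0..D} (tail_integral R G)"
    using ge D by (intro has_integral_le[OF _ integrable_integral[OF integrable_subinterval_real[OF int]]]) auto
  also have "\<dots> \<le> integral {0..D} (tail_integral R G) + integral {D..R} (tail_integral R G)"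
    using int D by (auto intro!: Henstock_Kurzweil_Integration.integral_nonneg integrable_subinterval_real[OF int]
        simp: tail_integral_def profile_integrable[OF G] profile_bounds[OF G])
  also have "\<dots> = integral {0..R} (tail_integral R G)"
    using int D by (intro Henstock_Kurzweil_Integration.integral_combine)
  finally show ?thesis using eq by simp
qed

section \<open>Energy loss of one answered move\<close>

text \<open>On \<open>{0..1/2}\<close> the integrand changes by
  \<open>(1 - G t - \<gamma> * t)^2 - \<gamma>^2 * t^2\<close>, and the integral of
  \<open>t^2\<close> there is 1/24.\<close>

lemma energy_flatten:
  assumes G: "profile G" and R: "1/2 \<le> R"
  defines "H \<equiv> \<lambda>t. if t \<in> {..1/2} then 1 else G t"
  shows "energy \<gamma> R G - \<gamma>\<^sup>2 / 24 \<le> energy \<gamma> R H"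
proof -
  let ?e = "\<lambda>G t. G t * (2 - G t) - 2 * \<gamma> * t * (G t :: real)"
  have H: "profile H" unfolding H_def using G by (intro profile_override) auto
  have "((\<lambda>t. (t - 0)\<^sup>2) has_integral ((1/2 - 0) ^ 3 - (0 - 0) ^ 3) / 3) {0..1/2::real}"
    by (rule has_integral_square) simp
  then have "((\<lambda>t. t\<^sup>2) has_integral 1/24) {0..1/2::real}" by (simp add: power3_eq_cube)
  from has_integral_mult_right[OF this, of "- (\<gamma>\<^sup>2)"]
  have sq: "((\<lambda>t. - (\<gamma>\<^sup>2) * t\<^sup>2) has_integral - (\<gamma>\<^sup>2) * (1/24)) {0..1/2}" .
  have dif: "((\<lambda>t. ?e H t - ?e G t) has_integral integral {0..1/2} (?e H) - integral {0..1/2} (?e G)) {0..1/2}"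
    by (intro has_integral_diff integrable_integral profile_integrable G H)
  have "- (\<gamma>\<^sup>2) * (1/24) \<le> integral {0..1/2} (?e H) - integral {0..1/2} (?e G)"
  proof (rule has_integral_le[OF sq dif])
    fix t :: real
    assume "t \<in> {0..1/2}"
    then have "?e H t - ?e G t + \<gamma>\<^sup>2 * t\<^sup>2 = (1 - G t - \<gamma> * t)\<^sup>2"
      by (simp add: H_def power2_eq_square algebra_simps)
    then have "0 \<le> ?e H t - ?e G t + \<gamma>\<^sup>2 * t\<^sup>2" by simp
    then show "- (\<gamma>\<^sup>2) * t\<^sup>2 \<le> ?e H t - ?e G t" by linarith
  qed
  moreover have "integral {1/2..R} (?e H) = integral {1/2..R} (?e G)"
    by (rule integral_spike[of "{1/2}"]) (auto simp: H_def)
  moreover have "integral {0..1/2} (?e F) + integral {1/2..R} (?e F) = energy \<gamma> R F" if "profile F" for F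
    unfolding energy_def using R that by (intro Henstock_Kurzweil_Integration.integral_combine profile_integrable) auto
  from this[OF G] this[OF H] calculation show ?thesis by simp
qed

text \<open>With \<open>q\<close> the midpoint, the integrand changes by the square of
  \<open>c - H t - \<gamma> * (t - q)\<close>, plus a constant multiple of \<open>c - H t\<close>,
  minus \<open>\<gamma>^2 * (t - q)^2\<close>. The middle term integrates to zero because
  \<open>c\<close> is the mean, and the last costs \<open>\<gamma>^2 / 12\<close>.\<close>

lemma energy_average:
  assumes H: "profile H" and one: "\<And>t. t \<le> 0 \<Longrightarrow> H t = 1"
    and a: "- 1 \<le> a" "a + 1 \<le> R" and \<gamma>: "0 \<le> \<gamma>"
  defines "c \<equiv> integral {a..a+1} H"
  defines "K \<equiv> \<lambda>t. if t \<in> {a..a+1} then c else H t"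
  shows "profile K" "energy \<gamma> R H - \<gamma>\<^sup>2 / 12 \<le> energy \<gamma> R K"
proof -
  let ?e = "\<lambda>G t. G t * (2 - G t) - 2 * \<gamma> * t * (G t :: real)"
  have Hc: "(H has_integral c) {a..a+1}"
    unfolding c_def by (intro integrable_integral profile_integrable H)
  have c0: "0 \<le> c"
    using has_integral_nonneg[OF Hc] profile_bounds[OF H] by simp
  have c1: "c \<le> 1"
    using has_integral_le[OF Hc has_integral_const_real[of 1 a "a+1"]] profile_bounds[OF H] by simp
  show K: "profile K" unfolding K_def using H c0 c1 by (intro profile_override) (auto simp: frontier_def)
  define lo where "lo = min 0 a"
  let ?d = "\<lambda>t. ?e K t - ?e H t"
  have dint: "?d integrable_on {x..y}" for x y
    by (intro integrable_diff profile_integrable K H)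
  have d_eq: "?d t = (if t \<in> {a..a+1} then ?d t else 0)" for t by (simp add: K_def)
  have "energy \<gamma> R K - energy \<gamma> R H = integral {0..R} ?d"
    unfolding energy_def
    by (rule Henstock_Kurzweil_Integration.integral_diff[symmetric]) (intro profile_integrable K H)+
  moreover have "integral {lo..0} ?d + integral {0..R} ?d = integral {lo..R} ?d"
    using a by (intro Henstock_Kurzweil_Integration.integral_combine dint) (auto simp: lo_def)
  moreover have "integral {lo..0} ?d \<le> integral {lo..0} (\<lambda>t. 0)"
  proof (rule integral_le[OF dint integrable_0])
    fix t
    assume "t \<in> {lo..0}"
    then have t: "t \<le> 0" by simp
    show "?d t \<le> 0"
    proof (cases "t \<in> {a..a+1}")
      case True
      then have "?d t = - (1 - c)\<^sup>2 + 2 * \<gamma> * (t * (1 - c))"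
        using one[OF t] by (simp add: K_def power2_eq_square algebra_simps)
      moreover have "\<gamma> * (t * (1 - c)) \<le> 0"
        using \<gamma> t c1 by (intro mult_nonneg_nonpos mult_nonpos_nonneg) auto
      moreover have "0 \<le> (1 - c)\<^sup>2" by simp
      ultimately show ?thesis by linarith
    qed (auto simp: K_def)
  qed
  moreover have "integral {lo..R} ?d = integral {a..a+1} ?d"
  proof -
    have "integral {lo..R} ?d = integral {lo..R} (\<lambda>t. if t \<in> {a..a+1} then ?d t else 0)"
      using d_eq by presburger
    also have "\<dots> = integral ({a..a+1} \<inter> {lo..R}) ?d" by (rule integral_restrict_Int)
    also have "{a..a+1} \<inter> {lo..R} = {a..a+1}" using a by (auto simp: lo_def)
    finally show ?thesis .
  qed
  moreover have "- (\<gamma>\<^sup>2) / 12 \<le> integral {a..a+1} ?d"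
  proof -
    define q where "q = a + 1/2"
    have "((\<lambda>t. (t - q)\<^sup>2) has_integral ((a + 1 - q) ^ 3 - (a - q) ^ 3) / 3) {a..a+1}"
      by (rule has_integral_square) simp
    then have sq: "((\<lambda>t. (t - q)\<^sup>2) has_integral 1/12) {a..a+1}"
      by (simp add: q_def power3_eq_cube)
    have "((\<lambda>t. 2 * (1 - c - \<gamma> * q) * (c - H t) - \<gamma>\<^sup>2 * (t - q)\<^sup>2) has_integral
        2 * (1 - c - \<gamma> * q) * ((a + 1 - a) *\<^sub>R c - c) - \<gamma>\<^sup>2 * (1/12)) {a..a+1}"
      using has_integral_const_real[of c a "a+1"]
      by (intro has_integral_diff has_integral_mult_right Hc sq) simp_all
    then have "((\<lambda>t. 2 * (1 - c - \<gamma> * q) * (c - H t) - \<gamma>\<^sup>2 * (t - q)\<^sup>2) has_integral - (\<gamma>\<^sup>2) / 12) {a..a+1}"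
      by simp
    then show ?thesis
    proof (rule has_integral_le[OF _ integrable_integral[OF dint]])
      fix t
      assume "t \<in> {a..a+1}"
      then have "?d t - (2 * (1 - c - \<gamma> * q) * (c - H t) - \<gamma>\<^sup>2 * (t - q)\<^sup>2)
          = (c - H t - \<gamma> * (t - q))\<^sup>2"
        by (simp add: K_def power2_eq_square algebra_simps)
      then have "0 \<le> ?d t - (2 * (1 - c - \<gamma> * q) * (c - H t) - \<gamma>\<^sup>2 * (t - q)\<^sup>2)" by simp
      then show "2 * (1 - c - \<gamma> * q) * (c - H t) - \<gamma>\<^sup>2 * (t - q)\<^sup>2 \<le> ?d t" by linarith
    qed
  qed
  ultimately show "energy \<gamma> R H - \<gamma>\<^sup>2 / 12 \<le> energy \<gamma> R K" by simp
qed

text \<open>Flattening followed by averaging, costing 1/24 + 1/12 = 1/8 times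
  \<open>\<gamma>^2\<close>. The function \<open>w\<close> is the tail integral after flattening;
  averaging then replaces it by its chord on \<open>{a..a+1}\<close> and leaves it alone
  elsewhere.\<close>

lemma energy_step:
  assumes G: "profile G" and a: "- 1/2 < a" "a + 1 \<le> R" and \<gamma>: "0 \<le> \<gamma>"
  defines "w \<equiv> (\<lambda>t. if t \<le> 1/2 then tail_integral R G (1/2) + (1/2 - t) else tail_integral R G t)"
  obtains K where "profile K" "energy \<gamma> R G - \<gamma>\<^sup>2 / 8 \<le> energy \<gamma> R K"
    and "\<And>t. t \<le> R \<Longrightarrow> t \<le> a \<or> a + 1 \<le> t \<Longrightarrow> tail_integral R K t = w t"
    and "\<And>t. a \<le> t \<Longrightarrow> t \<le> a + 1 \<Longrightarrow>
      tail_integral R K t = (a + 1 - t) * w a + (t - a) * w (a + 1)"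
proof -
  define H where "H = (\<lambda>t. if t \<in> {..1/2} then 1 else G t)"
  have H: "profile H" unfolding H_def using G by (intro profile_override) auto
  have wH: "tail_integral R H t = w t" if "t \<le> R" for t
  proof (cases "t \<le> 1/2")
    case True
    have "integral {t..1/2} H = integral {t..1/2} (\<lambda>t. 1)"
      by (intro Henstock_Kurzweil_Integration.integral_cong) (simp add: H_def)
    also have "\<dots> = 1/2 - t" using True by simp
    moreover have "tail_integral R H (1/2) = tail_integral R G (1/2)"
      by (intro tail_integral_cong) (simp add: H_def)
    ultimately show ?thesis
      using True a tail_integral_combine[OF H True, of R] by (simp add: w_def)
  next
    case False
    then show ?thesis by (auto simp: w_def H_def intro!: tail_integral_cong)
  qed
  define c where "c = integral {a..a+1} H"
  define K where "K = (\<lambda>t. if t \<in> {a..a+1} then c else H t)"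
  have K: "profile K" and eK: "energy \<gamma> R H - \<gamma>\<^sup>2 / 12 \<le> energy \<gamma> R K"
    unfolding K_def c_def using energy_average[OF H _ _ a(2) \<gamma>] a by (auto simp: H_def)
  have right: "tail_integral R K t = w t" if "a + 1 \<le> t" "t \<le> R" for t
    using that wH[OF that(2)] tail_integral_cong[of t R K H] by (auto simp: K_def)
  \<comment> \<open>The interval has length 1, so the mean \<open>c\<close> is also the drop of
    \<open>w\<close> across it. Hence averaging keeps the tail integral at \<open>a\<close> and at
    all points to its left.\<close>
  have c: "w a = c + w (a + 1)"
    using tail_integral_combine[OF H, of a "a+1" R] wH[of a] wH[of "a+1"] a by (simp add: c_def)
  have mid: "tail_integral R K t = (a + 1 - t) * c + w (a + 1)" if "a \<le> t" "t \<le> a + 1" for t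
  proof -
    have "integral {t..a+1} K = integral {t..a+1} (\<lambda>t. c)"
      using that by (intro Henstock_Kurzweil_Integration.integral_cong) (simp add: K_def)
    then show ?thesis
      using that a tail_integral_combine[OF K, of t "a+1" R] right[of "a+1"] by simp
  qed
  show thesis
  proof (rule that[OF K])
    show "energy \<gamma> R G - \<gamma>\<^sup>2 / 8 \<le> energy \<gamma> R K"
      using energy_flatten[OF G, of R \<gamma>] eK a by (simp add: H_def)
    show "tail_integral R K t = w t" if "t \<le> R" "t \<le> a \<or> a + 1 \<le> t" for t
      using that(2)
    proof
      assume t: "t \<le> a"
      have "integral {t..a} K = integral {t..a} H"
        by (rule integral_spike[of "{a}"]) (auto simp: K_def)
      then have "tail_integral R K t = tail_integral R H t"
        using tail_integral_combine[OF K t, of R] tail_integral_combine[OF H t, of R] a mid[of a] c wH[of a] by simp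
      then show ?thesis using wH that by simp
    qed (use right that in auto)
    show "tail_integral R K t = (a + 1 - t) * w a + (t - a) * w (a + 1)" if "a \<le> t" "t \<le> a + 1" for t
      using mid[OF that] c by (simp add: algebra_simps)
  qed
qed

section \<open>Upper bounds for the final energy\<close>

text \<open>For fixed \<open>t\<close> the integrand is a concave quadratic in \<open>G t\<close>
  with maximum \<open>(1 - \<kappa> * t)^2\<close>, attained at \<open>1 - \<kappa> * t\<close>.
  Beyond \<open>1 / \<kappa>\<close> that point is negative, and \<open>G t \<ge> 0\<close> makes
  the integrand nonpositive.\<close>

lemma energy_le:
  assumes G: "profile G" and \<kappa>: "0 < \<kappa>" "1 / \<kappa> \<le> R"
  shows "energy \<kappa> R G \<le> 1 / (3 * \<kappa>)"
proof -
  let ?e = "\<lambda>t. G t * (2 - G t) - 2 * \<kappa> * t * G t"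
  have int: "?e integrable_on {x..y}" for x y by (intro profile_integrable G)
  have "((\<lambda>t. (t - 1/\<kappa>)\<^sup>2) has_integral ((1/\<kappa> - 1/\<kappa>) ^ 3 - (0 - 1/\<kappa>) ^ 3) / 3) {0..1/\<kappa>}"
    using \<kappa> by (intro has_integral_square) simp
  from has_integral_mult_right[OF this, of "\<kappa>\<^sup>2"]
  have "((\<lambda>t. \<kappa>\<^sup>2 * (t - 1/\<kappa>)\<^sup>2) has_integral 1 / (3 * \<kappa>)) {0..1/\<kappa>}"
    using \<kappa> by (simp add: power2_eq_square power3_eq_cube field_simps)
  then have "integral {0..1/\<kappa>} ?e \<le> 1 / (3 * \<kappa>)"
  proof (rule has_integral_le[OF integrable_integral[OF int]])
    fix t
    have "\<kappa>\<^sup>2 * (t - 1/\<kappa>)\<^sup>2 = (1 - \<kappa> * t)\<^sup>2"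
      using \<kappa> by (simp add: power2_eq_square field_simps)
    moreover have "(1 - \<kappa> * t)\<^sup>2 - ?e t = (G t - (1 - \<kappa> * t))\<^sup>2"
      by (simp add: power2_eq_square algebra_simps)
    ultimately have "0 \<le> \<kappa>\<^sup>2 * (t - 1/\<kappa>)\<^sup>2 - ?e t" by simp
    then show "?e t \<le> \<kappa>\<^sup>2 * (t - 1/\<kappa>)\<^sup>2" by linarith
  qed
  moreover have "integral {1/\<kappa>..R} ?e \<le> integral {1/\<kappa>..R} (\<lambda>t. 0)"
  proof (rule integral_le[OF int integrable_0])
    fix t
    assume "t \<in> {1/\<kappa>..R}"
    then have "1 \<le> \<kappa> * t" using \<kappa> by (simp add: field_simps)
    then have "G t * (2 - G t - 2 * (\<kappa> * t)) \<le> 0"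
      using profile_bounds[OF G, of t] by (intro mult_nonneg_nonpos) auto
    then show "?e t \<le> 0" by (simp add: algebra_simps)
  qed
  moreover have "integral {0..1/\<kappa>} ?e + integral {1/\<kappa>..R} ?e = energy \<kappa> R G"
    unfolding energy_def using \<kappa> by (intro Henstock_Kurzweil_Integration.integral_combine int) auto
  ultimately show ?thesis by simp
qed

text \<open>Splits the linear penalty: the part with coefficient \<kappa> is absorbed by maximizing
  over all profiles, while the remainder is a multiple of the first moment, for which a lower bound
  is known.\<close>

lemma energy_shift:
  assumes "profile G"
  shows "energy \<gamma> R G = energy \<kappa> R G - 2 * (\<gamma> - \<kappa>) * integral {0..R} (\<lambda>t. t * G t)"
proof -
  have "energy \<gamma> R G = integral {0..R} (\<lambda>t. (G t * (2 - G t) - 2 * \<kappa> * t * G t) - 2 * (\<gamma> - \<kappa>) * (t * G t))"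
    unfolding energy_def by (simp add: algebra_simps)
  also have "\<dots> = energy \<kappa> R G - integral {0..R} (\<lambda>t. 2 * (\<gamma> - \<kappa>) * (t * G t))"
    unfolding energy_def using assms
    by (intro Henstock_Kurzweil_Integration.integral_diff integrable_on_mult_right profile_integrable)
  finally show ?thesis by simp
qed

subsection \<open>Domination\<close>

text \<open>The mass bound extends domination from \<open>t \<ge> 1/2\<close> to
  \<open>t \<ge> - 1/2\<close> once the profile is flattened. The move keeps the potential outside
  its interval, and inside convexity puts the new potential below the chord, which is what averaging
  produces.\<close>

lemma dominating_profile_step:
  assumes f: "distribution f" and g: "distribution (\<lambda>x. f x + \<delta> x)"
    and mv: "is_move (a, b, \<delta>)" and a: "s - 1/2 < a" "b - s \<le> R"
    and mass: "mass f {x. x > s - 1/2} \<le> m" and m: "0 \<le> m"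
    and G: "profile G" and \<gamma>: "0 \<le> \<gamma>"
    and dom: "\<And>t. 1/2 \<le> t \<Longrightarrow> t \<le> R \<Longrightarrow> pot UNIV f (s + t) \<le> m * tail_integral R G t"
  obtains K where "profile K" "energy \<gamma> R G - \<gamma>\<^sup>2 / 8 \<le> energy \<gamma> R K"
    and "\<And>t. - 1/2 \<le> t \<Longrightarrow> t \<le> R \<Longrightarrow>
      pot UNIV (\<lambda>x. f x + \<delta> x) (s + t) \<le> m * tail_integral R K t"
proof -
  define w where "w = (\<lambda>t. if t \<le> 1/2 then tail_integral R G (1/2) + (1/2 - t) else tail_integral R G t)"
  define y where "y = a - s"
  let ?g = "\<lambda>x. f x + \<delta> x"
  have b: "b = a + 1" and fin: "finite (supp f)" "finite (supp \<delta>)"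
    and \<delta>: "supp \<delta> \<subseteq> {a..b}" "moment 0 \<delta> = 0" "moment 1 \<delta> = 0"
    using mv f by (auto simp: is_move_def signed_distribution_def distribution_def)
  have y: "- 1/2 < y" "y + 1 \<le> R" using a b by (auto simp: y_def)
  obtain K where K: "profile K" "energy \<gamma> R G - \<gamma>\<^sup>2 / 8 \<le> energy \<gamma> R K"
    and out: "\<And>t. t \<le> R \<Longrightarrow> t \<le> y \<or> y + 1 \<le> t \<Longrightarrow> tail_integral R K t = w t"
    and mid: "\<And>t. y \<le> t \<Longrightarrow> t \<le> y + 1 \<Longrightarrow>
      tail_integral R K t = (y + 1 - t) * w y + (t - y) * w (y + 1)"
    using energy_step[OF G y \<gamma>] unfolding w_def by metis
  have fw: "pot UNIV f (s + t) \<le> m * w t" if t: "- 1/2 \<le> t" "t \<le> R" for t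
  proof (cases "t \<le> 1/2")
    case True
    \<comment> \<open>To the left of 1/2 the potential rises with slope at most \<open>m\<close>,
      which is exactly the slope of \<open>m * w\<close> there.\<close>
    have "mass f {x. x > s + t} \<le> mass f {x. x > s - 1/2}"
      unfolding mass_def using f t by (intro sum_mono2) (auto simp: distribution_def)
    then have "pot UNIV f (s + t) \<le> pot UNIV f (s + 1/2) + m * (s + 1/2 - (s + t))"
      using True mass by (intro pot_slope[OF f]) auto
    also have "\<dots> \<le> m * tail_integral R G (1/2) + m * (1/2 - t)"
      using dom[of "1/2"] y by simp
    finally show ?thesis using True by (simp add: w_def distrib_left)
  qed (use dom t in \<open>auto simp: w_def\<close>)
  have gw: "pot UNIV ?g (s + t) \<le> m * w t" if "- 1/2 \<le> t" "t \<le> R" "t \<le> y \<or> y + 1 \<le> t" for t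
    using fw[OF that(1,2)] pot_balanced_outside[OF \<delta>, of "s + t"] that(3)
    by (auto simp: pot_add[OF fin] y_def b)
  show thesis
  proof (rule that[OF K])
    fix t
    assume t: "- 1/2 \<le> t" "t \<le> R"
    show "pot UNIV ?g (s + t) \<le> m * tail_integral R K t"
    proof (cases "t \<le> y \<or> y + 1 \<le> t")
      case True
      then show ?thesis using gw[OF t] out t by simp
    next
      case False
      then have ty: "y \<le> t" "t \<le> y + 1" by auto
      have "pot UNIV ?g (s + t) \<le> (y + 1 - t) * pot UNIV ?g (s + y) + (t - y) * pot UNIV ?g (s + (y + 1))"
        using pot_le_chord[OF g, of "s + y" "s + t" UNIV] ty by (simp add: add.assoc)
      also have "\<dots> \<le> (y + 1 - t) * (m * w y) + (t - y) * (m * w (y + 1))"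
        using ty y by (intro add_mono mult_left_mono gw) auto
      also have "\<dots> = m * tail_integral R K t"
        unfolding mid[OF ty] by (simp add: algebra_simps)
      finally show ?thesis .
    qed
  qed
qed

section \<open>Induction over the moves and the final count\<close>

theorem mainTheorem14:
  fixes r m d p :: real and l :: nat
    and v :: "nat \<Rightarrow> move" and \<mu> :: "nat \<Rightarrow> real \<Rightarrow> real"
  assumes "m > 0" and "d > 1" and "0 < p" and "p < 1"
    and "distribution (\<mu> 0)"
    and "\<And>i. i < l \<Longrightarrow> is_move (v i) \<and> applies (v i) (\<mu> i)
              \<and> \<mu> (Suc i) = apply_move (v i) (\<mu> i)"
    and "mass (\<mu> 0) {x. x > r} = 0"
    and "mu_max \<mu> l {x. x > r} \<le> m"
    and "mu_max \<mu> l {x. x \<ge> r + d} \<ge> p * m"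
  shows "real (card {i. i < l \<and> move_center (v i) > r + 1/2})
           \<ge> sqrt 3 * p powr (3/2) * (d - 1/2) ^ 3"
proof -
  note step = assms(6)
  define s where "s = r + 1/2"
  define D where "D = d - 1/2"
  \<comment> \<open>The final inequality has the form \<open>(\<gamma> - \<kappa>) * p * D^2 - 1 /
    (3 * \<kappa>) \<le> N * \<gamma>^2 / 8\<close>. Its left side is largest in \<kappa> when
    \<open>3 * \<kappa>^2 * p * D^2 = 1\<close>, and the resulting bound on \<open>N\<close> is then
    best at \<open>\<gamma> = 4 * \<kappa>\<close>.\<close>
  define \<kappa> where "\<kappa> = 1 / (sqrt (3 * p) * D)"
  define \<gamma> where "\<gamma> = 4 * \<kappa>"
  define N where "N n = card {i. i < n \<and> move_center (v i) > s}" for n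
  have D: "1/2 < D" using assms by (simp add: D_def)
  have \<kappa>: "0 < \<kappa>" using D assms by (simp add: \<kappa>_def)
  \<comment> \<open>The cutoff must exceed \<open>D\<close> for the moment bound,
    \<open>1 / \<kappa>\<close> for the maximal energy, and the right ends of all moves relative to
    the origin \<open>s\<close>.\<close>
  define X where "X = insert D (insert (1 / \<kappa>) ((\<lambda>i. fst (snd (v i)) - s) ` {..<l}))"
  define R where "R = Max X"
  have "finite X" by (simp add: X_def)
  then have XR: "x \<le> R" if "x \<in> X" for x using that by (simp add: R_def)
  have R: "D \<le> R" "1 / \<kappa> \<le> R" and Rb: "\<And>i. i < l \<Longrightarrow> fst (snd (v i)) - s \<le> R"
    by (auto intro!: XR simp: X_def)
  have mass_le: "mass (\<mu> i) {x. x > s - 1/2} \<le> m" if "i \<le> l" for i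
  proof -
    have "mass (\<mu> i) {x. x > r} \<le> mu_max \<mu> l {x. x > r}"
      unfolding mu_max_def using that by (intro Max_ge) auto
    then show ?thesis using assms by (simp add: s_def)
  qed
  \<comment> \<open>The invariant concerns only mass beyond \<open>s + 1/2\<close>, so that moves
    centered at or left of \<open>s\<close> cannot disturb it. It starts from the zero profile, as
    there is no mass beyond \<open>r\<close>.\<close>
  have "n \<le> l \<Longrightarrow> distribution (\<mu> n) \<and> (\<exists>G. profile G \<and> - (real (N n) * \<gamma>\<^sup>2 / 8) \<le> energy \<gamma> R G \<and>
    (\<forall>t. 0 \<le> t \<and> t \<le> R \<longrightarrow> pot {s + 1/2<..} (\<mu> n) (s + t) \<le> m * tail_integral R G t))" for n
  proof (induction n)
    case 0
    have "\<forall>x\<in>supp (\<mu> 0) \<inter> {x. x > r}. \<mu> 0 x = 0"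
      using assms(5,7) unfolding mass_def distribution_def
      by (subst (asm) sum_nonneg_eq_0_iff) auto
    then have "supp (\<mu> 0) \<inter> {s + 1/2<..} = {}" by (auto simp: supp_def s_def)
    then have "pot {s + 1/2<..} (\<mu> 0) t = 0" for t by (rule pot_disjoint)
    then show ?case
      using assms(5) by (intro conjI exI[of _ "\<lambda>_. 0"])
        (auto simp: profile_const energy_def tail_integral_def N_def)
  next
    case (Suc n)
    then have n: "n < l" by simp
    obtain a b \<delta> where v: "v n = (a, b, \<delta>)" by (cases "v n")
    have mv: "is_move (a, b, \<delta>)" and \<mu>: "\<mu> (Suc n) = (\<lambda>x. \<mu> n x + \<delta> x)"
      and dist: "distribution (\<lambda>x. \<mu> n x + \<delta> x)"
      using step[OF n] by (auto simp: v applies_def apply_move_def)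
    obtain G where dn: "distribution (\<mu> n)" and G: "profile G" "- (real (N n) * \<gamma>\<^sup>2 / 8) \<le> energy \<gamma> R G"
      and dom: "\<And>t. 0 \<le> t \<Longrightarrow> t \<le> R \<Longrightarrow> pot {s + 1/2<..} (\<mu> n) (s + t) \<le> m * tail_integral R G t"
      using Suc by auto
    have b: "b = a + 1" and supp: "supp \<delta> \<subseteq> {a..b}" "finite (supp \<delta>)"
      using mv by (auto simp: is_move_def signed_distribution_def)
    have split: "{i. i < Suc n \<and> move_center (v i) > s} =
      {i. i < n \<and> move_center (v i) > s} \<union> (if move_center (v n) > s then {n} else {})"
      by (auto simp: less_Suc_eq)
    show ?case
    proof (cases "move_center (v n) > s")
      case True
      then have a: "s - 1/2 < a" by (simp add: v move_center_def b field_simps)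
      \<comment> \<open>For \<open>t \<ge> 1/2\<close> the mass at or below \<open>s + 1/2\<close>
        has kernel value zero, so restricted and full potentials agree; the full one is needed
        because only it sees the whole balanced move.\<close>
      have dom': "pot UNIV (\<mu> n) (s + t) \<le> m * tail_integral R G t" if "1/2 \<le> t" "t \<le> R" for t
        using dom[of t] pot_tail_eq[OF dn, of "s + 1/2" "s + t"] that by simp
      obtain K where K: "profile K" "energy \<gamma> R G - \<gamma>\<^sup>2 / 8 \<le> energy \<gamma> R K"
        and domK: "\<And>t. - 1/2 \<le> t \<Longrightarrow> t \<le> R \<Longrightarrow> pot UNIV (\<mu> (Suc n)) (s + t) \<le> m * tail_integral R K t"
        using dominating_profile_step[OF dn dist mv a _ mass_le _ G(1) _ dom', of \<gamma>]
          Rb[OF n] n \<kappa> assms(1) unfolding \<mu> by (auto simp: v \<gamma>_def)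
      have "pot {s + 1/2<..} (\<mu> (Suc n)) (s + t) \<le> m * tail_integral R K t" if "0 \<le> t" "t \<le> R" for t
        using pot_mono_set[of "\<mu> (Suc n)" "{s + 1/2<..}" UNIV "s + t"] domK[of t] dist that
        by (simp add: \<mu>)
      moreover have "N (Suc n) = Suc (N n)" unfolding N_def split using True by simp
      then have "- (real (N (Suc n)) * \<gamma>\<^sup>2 / 8) \<le> energy \<gamma> R K"
        using G(2) K(2) by (simp add: algebra_simps add_divide_distrib)
      ultimately show ?thesis using K(1) dist \<mu> by auto
    next
      case False
      \<comment> \<open>Center at most \<open>s\<close> and length 1 put the interval at or below
        \<open>s + 1/2\<close>, so the old profile still serves.\<close>
      then have "supp \<delta> \<inter> {s + 1/2<..} = {}"
        using supp(1) b by (fastforce simp: v move_center_def field_simps)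
      then have "pot {s + 1/2<..} (\<mu> (Suc n)) t = pot {s + 1/2<..} (\<mu> n) t" for t
        using dn supp(2) by (simp add: \<mu> pot_add distribution_def pot_disjoint)
      moreover have "N (Suc n) = N n" unfolding N_def split using False by simp
      ultimately show ?thesis using G dom dist \<mu> by auto
    qed
  qed
  note dominated = this
  have "mu_max \<mu> l {x. x \<ge> r + d} \<in> (\<lambda>i. mass (\<mu> i) {x. x \<ge> r + d}) ` {0..l}"
    unfolding mu_max_def by (intro Max_in) auto
  then obtain j where j: "j \<le> l" "p * m \<le> mass (\<mu> j) {x. x \<ge> r + d}" using assms(9) by auto
  obtain G where dj: "distribution (\<mu> j)" and G: "profile G" "- (real (N j) * \<gamma>\<^sup>2 / 8) \<le> energy \<gamma> R G"
    and dom: "\<And>t. 0 \<le> t \<Longrightarrow> t \<le> R \<Longrightarrow> pot {s + 1/2<..} (\<mu> j) (s + t) \<le> m * tail_integral R G t"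
    using dominated[OF j(1)] by auto
  have "p * D\<^sup>2 / 2 \<le> integral {0..R} (\<lambda>t. t * G t)"
  proof (rule first_moment_ge[OF G(1)])
    fix t
    assume t: "0 \<le> t" "t \<le> D"
    \<comment> \<open>Here \<open>r + d = s + D\<close>, and \<open>D > 1/2\<close> places it beyond
      the cut at \<open>s + 1/2\<close>.\<close>
    have "p * m * (r + d - (s + t)) \<le> pot {s + 1/2<..} (\<mu> j) (s + t)"
      using j t D by (intro pot_tail_ge dj) (auto simp: s_def D_def)
    also have "\<dots> \<le> m * tail_integral R G t" using dom t R by simp
    finally have "m * (p * (D - t)) \<le> m * tail_integral R G t"
      by (simp add: s_def D_def algebra_simps)
    then show "p * (D - t) \<le> tail_integral R G t" using assms(1) by simp
  qed (use D R in auto)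
  \<comment> \<open>The factor \<open>6 * \<kappa>\<close> is
    \<open>2 * (\<gamma> - \<kappa>)\<close>, the coefficient of the first moment when the penalty
    is split.\<close>
  then have "6 * \<kappa> * (p * D\<^sup>2 / 2) \<le> 6 * \<kappa> * integral {0..R} (\<lambda>t. t * G t)"
    using \<kappa> by (intro mult_left_mono) auto
  moreover have "energy \<gamma> R G \<le> 1 / (3 * \<kappa>) - 6 * \<kappa> * integral {0..R} (\<lambda>t. t * G t)"
    using energy_shift[OF G(1), of \<gamma> R \<kappa>] energy_le[OF G(1) \<kappa> R(2)] by (simp add: \<gamma>_def)
  ultimately have main: "6 * \<kappa> * (p * D\<^sup>2 / 2) - 1 / (3 * \<kappa>) \<le> real (N j) * (2 * \<kappa>\<^sup>2)"
    using G(2) by (simp add: \<gamma>_def power_mult_distrib)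
  \<comment> \<open>As \<open>q\<close> is the reciprocal of \<kappa>, the inequality
    \<open>main\<close> becomes a bound by \<open>q ^ 3 / 3\<close>.\<close>
  define q where "q = sqrt (3 * p) * D"
  have q: "0 < q" "\<kappa> = 1 / q" "p * D\<^sup>2 = q\<^sup>2 / 3"
    using D assms(3) by (auto simp: q_def \<kappa>_def power_mult_distrib)
  have "6 * \<kappa> * (p * D\<^sup>2 / 2) - 1 / (3 * \<kappa>) = 2 * q / 3"
    unfolding q(2,3) using q(1) by (simp add: field_simps power2_eq_square)
  then have "2 * q / 3 \<le> real (N j) * (2 * \<kappa>\<^sup>2)"
    using main by linarith
  then have "2 * q / 3 \<le> real (N j) * (2 / q\<^sup>2)"
    by (simp add: q(2) power_divide)
  then have "q ^ 3 / 3 \<le> real (N j)"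
    using q(1) by (simp add: field_simps power2_eq_square power3_eq_cube)
  moreover have "q ^ 3 / 3 = sqrt 3 * p powr (3/2) * (d - 1/2) ^ 3"
  proof -
    have "p powr (3/2) = p powr (1 + 1/2)" by simp
    also have "\<dots> = p * sqrt p" using assms(3) by (subst powr_add) (simp add: powr_half_sqrt)
    finally have "p powr (3/2) = p * sqrt p" .
    moreover have cube: "sqrt (3 * p) ^ 3 = (sqrt (3 * p))\<^sup>2 * sqrt (3 * p)"
      by (simp add: power2_eq_square power3_eq_cube)
    have "sqrt (3 * p) ^ 3 = 3 * p * (sqrt 3 * sqrt p)"
      unfolding cube using assms(3) by (simp add: real_sqrt_mult power_mult_distrib)
    ultimately show ?thesis by (simp add: q_def D_def power_mult_distrib)
  qed
  moreover have "N j \<le> N l"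
    unfolding N_def using j(1) by (intro card_mono) auto
  ultimately show ?thesis by (simp add: N_def s_def)
qed

end
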